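(* Let $\mathcal{H}$ be a $d$-dimensional complex Hilbert space and let $\mathcal{N}=\{d^{-1}|\phi_j\rangle\langle\phi_j|\}_{j=1}^{d^2}$ be a SIC-POVM in $\mathcal{H}$. For an arbitrary density matrix $\rho$ on $\mathcal{H}$, the generated probability distribution satisfies $$\sum_{j=1}^{d^2}p_j(\mathcal{N}|\rho)^2=\frac{\mathrm{tr}(\rho^2)+1}{d(d+1)}.$$
   Context: A density matrix on $\mathcal{H}$ is a positive semidefinite operator of trace $1$. A SIC-POVM (symmetric informationally complete POVM) in $d$-dimensional $\mathcal{H}$ is a set of $d^2$ operators $d^{-1}|\phi_j\rangle\langle\phi_j|$, $j=1,\ldots,d^2$, with unit vectors $|\phi_j\rangle$ satisfying $|\langle\phi_j|\phi_k\rangle|^2=\frac{1}{d+1}$ for all $j\ne k$ and the completeness relation $\frac1d\sum_{j=1}^{d^2}|\phi_j\rangle\langle\phi_j|=\mathbf{1}$ (identity operator). The generated probabilities are $p_j(\mathcal{N}|\rho)=d^{-1}\langle\phi_j|\rho|\phi_j\rangle$. *)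

theory Defs
  imports Complex_Main
begin

text \<open>
  A finite-dimensional complex Hilbert space. Completeness is automatic in finite dimension, and
  the inner product is linear in the second argument, so that \<open>inner x y\<close> is the bracket
  \<open>\<langle>x|y\<rangle>\<close>. The parameter \<open>Basis\<close> inherited from the library is an arbitrary
  linear basis; it is not required to be orthonormal.
\<close>
locale complex_hilbert_space = finite_dimensional_vector_space scale Basis
  for scale :: "complex \<Rightarrow> 'a::ab_group_add \<Rightarrow> 'a" (infixr "*s" 75)
    and Basis :: "'a set" +
  fixes inner :: "'a \<Rightarrow> 'a \<Rightarrow> complex"
  assumes inner_commute: "inner y x = cnj (inner x y)"
    and inner_add_right: "inner x (y + z) = inner x y + inner x z"
    and inner_scale_right: "inner x (c *s y) = c * inner x y"
    and inner_pos: "x \<noteq> 0 \<Longrightarrow> 0 < Re (inner x x)"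
begin

text \<open>
  The trace as the sum of the diagonal entries of the matrix of \<open>A\<close> with respect to
  \<open>Basis\<close>; for linear \<open>A\<close> it does not depend on the basis.
\<close>
definition op_trace :: "('a \<Rightarrow> 'a) \<Rightarrow> complex" where
  "op_trace A = (\<Sum>b\<in>Basis. representation Basis (A b) b)"

definition positive_semidefinite :: "('a \<Rightarrow> 'a) \<Rightarrow> bool" where
  "positive_semidefinite A \<longleftrightarrow>
     Vector_Spaces.linear scale scale A \<and>
     (\<forall>x. inner x (A x) \<in> \<real> \<and> 0 \<le> Re (inner x (A x)))"

definition density_operator :: "('a \<Rightarrow> 'a) \<Rightarrow> bool" where
  "density_operator \<rho> \<longleftrightarrow> positive_semidefinite \<rho> \<and> op_trace \<rho> = 1"

text \<open>The operator \<open>|x\<rangle>\<langle>y|\<close>.\<close>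
definition ketbra :: "'a \<Rightarrow> 'a \<Rightarrow> 'a \<Rightarrow> 'a" where
  "ketbra x y z = inner y z *s x"

text \<open>
  With \<open>d = dim UNIV\<close>: the operators \<open>(1/d)|\<phi>\<^sub>j\<rangle>\<langle>\<phi>\<^sub>j|\<close>, which make up the
  measurement determined by the family \<open>\<phi>\<close>.
\<close>
definition povm_element :: "(nat \<Rightarrow> 'a) \<Rightarrow> nat \<Rightarrow> 'a \<Rightarrow> 'a" where
  "povm_element \<phi> j x = (1 / of_nat (dim UNIV)) *s ketbra (\<phi> j) (\<phi> j) x"

text \<open>Only the values of \<open>\<phi>\<close> on the indices \<open>1, \<dots>, d\<^sup>2\<close> matter.\<close>
definition sic_povm :: "(nat \<Rightarrow> 'a) \<Rightarrow> bool" where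
  "sic_povm \<phi> \<longleftrightarrow>
     (\<forall>j\<in>{1..(dim UNIV)\<^sup>2}. inner (\<phi> j) (\<phi> j) = 1) \<and>
     (\<forall>j\<in>{1..(dim UNIV)\<^sup>2}. \<forall>k\<in>{1..(dim UNIV)\<^sup>2}. j \<noteq> k \<longrightarrow>
        (cmod (inner (\<phi> j) (\<phi> k)))\<^sup>2 = 1 / (real (dim UNIV) + 1)) \<and>
     (\<forall>x. (\<Sum>j\<in>{1..(dim UNIV)\<^sup>2}. povm_element \<phi> j x) = x)"

text \<open>
  Complex-valued: that the value is real for a density operator is a consequence of positivity.
\<close>
definition sic_prob :: "(nat \<Rightarrow> 'a) \<Rightarrow> ('a \<Rightarrow> 'a) \<Rightarrow> nat \<Rightarrow> complex" where
  "sic_prob \<phi> \<rho> j = (1 / of_nat (dim UNIV)) * inner (\<phi> j) (\<rho> (\<phi> j))"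

end

end

theory Submission
  imports Defs
begin

text \<open>
  By completeness the vectors \<open>\<phi>\<^sub>j\<close> form a tight frame, so operators are faithfully represented by
  the matrices \<open>\<langle>\<phi>\<^sub>j|A|\<phi>\<^sub>k\<rangle>\<close> and \<open>d tr A = \<Sum>\<^sub>j \<langle>\<phi>\<^sub>j|A|\<phi>\<^sub>j\<rangle>\<close>. The equal overlaps make
  \<open>\<Sum>\<^sub>j (|\<phi>\<^sub>j\<rangle>\<langle>\<phi>\<^sub>j|)\<^sup>\<otimes>\<^sup>2 - d / (d + 1) * (1 + SWAP)\<close> an operator of Hilbert--Schmidt norm zero;
  contracting it with \<open>\<rho> \<otimes> \<rho>\<close> yields
  \<open>\<Sum>\<^sub>j \<langle>\<phi>\<^sub>j|\<rho>|\<phi>\<^sub>j\<rangle>\<^sup>2 = d / (d + 1) * ((tr \<rho>)\<^sup>2 + tr (\<rho>\<^sup>2))\<close>.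
\<close>

section \<open>Reordering of iterated finite sums\<close>

lemma sum_rotate_right:
  "(\<Sum>a\<in>A. \<Sum>b\<in>B. \<Sum>c\<in>C. f a b c) = (\<Sum>c\<in>C. \<Sum>a\<in>A. \<Sum>b\<in>B. f a b c)"
  by (subst sum.swap[of _ C B]) (rule sum.swap)

lemma sum_swap_pairs:
  "(\<Sum>a\<in>A. \<Sum>b\<in>B. \<Sum>c\<in>C. \<Sum>d\<in>D. f a b c d) =
   (\<Sum>c\<in>C. \<Sum>d\<in>D. \<Sum>a\<in>A. \<Sum>b\<in>B. f a b c d)"
  by (subst sum_rotate_right) (simp only: sum_rotate_right[of _ D B A])

section \<open>Gram matrix of a SIC and operators on the tensor square\<close>

text \<open>
  The matrix \<open>G j k\<close> stands for \<open>\<langle>\<phi>\<^sub>j|\<phi>\<^sub>k\<rangle>\<close>; below, a matrix with four indices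
  \<open>k l m n\<close> is an operator on the twofold tensor product, with row \<open>(k, l)\<close> and column \<open>(m, n)\<close>.
\<close>
locale sic_gram =
  fixes I :: "'i set" and G :: "'i \<Rightarrow> 'i \<Rightarrow> complex" and d :: nat
  assumes finite_index: "finite I"
    and card_index: "card I = d\<^sup>2"
    and dim_pos: "0 < d"
    and gram_cnj: "\<And>j k. cnj (G j k) = G k j"
    and gram_mult: "\<And>j l. j \<in> I \<Longrightarrow> l \<in> I \<Longrightarrow> (\<Sum>k\<in>I. G j k * G k l) = of_nat d * G j l"
    and gram_diag: "\<And>j. j \<in> I \<Longrightarrow> G j j = 1"
    and gram_off_diag: "\<And>j k. j \<in> I \<Longrightarrow> k \<in> I \<Longrightarrow> j \<noteq> k \<Longrightarrow>
        (cmod (G j k))\<^sup>2 = 1 / (real d + 1)"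
begin

text \<open>The frame operator of the vectors \<open>phi_j \<otimes> phi_j\<close>, written as a
  matrix between the product vectors \<open>phi_k \<otimes> phi_l\<close> and
  \<open>phi_m \<otimes> phi_n\<close>.\<close>

definition fourth_moment :: "'i \<Rightarrow> 'i \<Rightarrow> 'i \<Rightarrow> 'i \<Rightarrow> complex" where
  "fourth_moment k l m n = (\<Sum>j\<in>I. (G k j * G l j) * (G j m * G j n))"

text \<open>The Gram matrix of \<open>1 + SWAP\<close>.\<close>
definition sym_kernel :: "'i \<Rightarrow> 'i \<Rightarrow> 'i \<Rightarrow> 'i \<Rightarrow> complex" where
  "sym_kernel k l m n = G k m * G l n + G k n * G l m"

lemma fourth_moment_cnj: "cnj (fourth_moment k l m n) = fourth_moment m n k l"
  by (simp add: fourth_moment_def gram_cnj mult_ac)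

lemma sym_kernel_cnj: "cnj (sym_kernel k l m n) = sym_kernel m n k l"
  by (simp add: sym_kernel_def gram_cnj mult_ac)

lemma fourth_moment_contract:
  "(\<Sum>p\<in>I. \<Sum>q\<in>I. fourth_moment k l p q * (X p * Y q)) =
   (\<Sum>j\<in>I. (G k j * G l j) * ((\<Sum>p\<in>I. G j p * X p) * (\<Sum>q\<in>I. G j q * Y q)))"
proof -
  have "(\<Sum>p\<in>I. \<Sum>q\<in>I. fourth_moment k l p q * (X p * Y q)) =
        (\<Sum>p\<in>I. \<Sum>q\<in>I. \<Sum>j\<in>I. (G k j * G l j) * ((G j p * X p) * (G j q * Y q)))"
    by (simp add: fourth_moment_def sum_distrib_left sum_distrib_right mult_ac)
  also have "\<dots> = (\<Sum>j\<in>I. (G k j * G l j) * ((\<Sum>p\<in>I. G j p * X p) * (\<Sum>q\<in>I. G j q * Y q)))"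
    by (subst sum_rotate_right) (simp only: sum_product, simp only: sum_distrib_left)
  finally show ?thesis .
qed

lemma sym_kernel_contract:
  "(\<Sum>p\<in>I. \<Sum>q\<in>I. sym_kernel k l p q * (X p * Y q)) =
   (\<Sum>p\<in>I. G k p * X p) * (\<Sum>q\<in>I. G l q * Y q)
   + (\<Sum>q\<in>I. G l q * X q) * (\<Sum>p\<in>I. G k p * Y p)"
  by (simp add: sym_kernel_def sum_product sum.distrib[symmetric] algebra_simps)

text \<open>The frame operator is supported on the symmetric subspace, where \<open>1 + SWAP\<close>
  acts as 2. Each of the two summations over the redundant frame contributes a factor
  \<open>d\<close> through \<open>gram_mult\<close>.\<close>

lemma fourth_moment_mult_sym_kernel:
  assumes "m \<in> I" "n \<in> I"
  shows "(\<Sum>p\<in>I. \<Sum>q\<in>I. fourth_moment k l p q * sym_kernel p q m n)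
       = 2 * (of_nat d)\<^sup>2 * fourth_moment k l m n"
proof -
  have "(\<Sum>p\<in>I. \<Sum>q\<in>I. fourth_moment k l p q * sym_kernel p q m n)
      = (\<Sum>p\<in>I. \<Sum>q\<in>I. fourth_moment k l p q * (G p m * G q n))
      + (\<Sum>p\<in>I. \<Sum>q\<in>I. fourth_moment k l p q * (G p n * G q m))"
    by (simp add: sym_kernel_def sum.distrib distrib_left)
  also have "\<dots> = 2 * (\<Sum>j\<in>I. (G k j * G l j) * ((of_nat d * G j m) * (of_nat d * G j n)))"
    unfolding fourth_moment_contract using assms by (simp add: gram_mult mult_ac)
  also have "\<dots> = 2 * (of_nat d)\<^sup>2 * fourth_moment k l m n"
    by (simp add: fourth_moment_def sum_distrib_left power2_eq_square mult_ac)
  finally show ?thesis .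
qed

text \<open>This is (1 + SWAP)^2 = 2 (1 + SWAP), again with one factor \<open>d\<close> per frame
  summation.\<close>

lemma sym_kernel_mult_sym_kernel:
  assumes "k \<in> I" "l \<in> I" "m \<in> I" "n \<in> I"
  shows "(\<Sum>p\<in>I. \<Sum>q\<in>I. sym_kernel k l p q * sym_kernel p q m n)
       = 2 * (of_nat d)\<^sup>2 * sym_kernel k l m n"
proof -
  have "(\<Sum>p\<in>I. \<Sum>q\<in>I. sym_kernel k l p q * sym_kernel p q m n)
      = (\<Sum>p\<in>I. \<Sum>q\<in>I. sym_kernel k l p q * (G p m * G q n))
      + (\<Sum>p\<in>I. \<Sum>q\<in>I. sym_kernel k l p q * (G p n * G q m))"
    by (simp add: sym_kernel_def[of _ _ m n] sum.distrib distrib_left)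
  also have "\<dots> = 2 * (of_nat d)\<^sup>2 * sym_kernel k l m n"
    unfolding sym_kernel_contract using assms
    by (simp add: gram_mult) (simp add: sym_kernel_def power2_eq_square algebra_simps)
  finally show ?thesis .
qed

section \<open>Traces over the frame and the 2-design identity\<close>

lemma gram_double_sum: "(\<Sum>k\<in>I. \<Sum>l\<in>I. G k l * G l k) = (of_nat d)^3"
proof -
  have "(\<Sum>k\<in>I. \<Sum>l\<in>I. G k l * G l k) = (\<Sum>k\<in>I. of_nat d * 1)"
    by (intro sum.cong refl) (simp add: gram_mult gram_diag)
  then show ?thesis
    by (simp add: card_index power2_eq_square power3_eq_cube)
qed

text \<open>Summing over frame pairs multiplies the trace by d^2, and \<open>1 + SWAP\<close> has
  trace d^2 + d.\<close>

lemma sym_kernel_trace: "(\<Sum>k\<in>I. \<Sum>l\<in>I. sym_kernel k l k l) = (of_nat d)^4 + (of_nat d)^3"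
proof -
  have "(\<Sum>k\<in>I. \<Sum>l\<in>I. sym_kernel k l k l) = (\<Sum>k\<in>I. \<Sum>l\<in>I. 1 + G k l * G l k)"
    by (intro sum.cong refl) (simp add: sym_kernel_def gram_diag)
  also have "\<dots> = (of_nat d)^4 + (of_nat d)^3"
    by (simp add: sum.distrib gram_double_sum card_index power_add[symmetric])
  finally show ?thesis .
qed

lemma fourth_moment_trace: "(\<Sum>k\<in>I. \<Sum>l\<in>I. fourth_moment k l k l) = (of_nat d)^4"
proof -
  have "(\<Sum>k\<in>I. \<Sum>l\<in>I. fourth_moment k l k l)
      = (\<Sum>k\<in>I. \<Sum>l\<in>I. \<Sum>j\<in>I. (G j k * G k j) * (G j l * G l j))"
    by (simp add: fourth_moment_def mult_ac)
  also have "\<dots> = (\<Sum>j\<in>I. (\<Sum>k\<in>I. G j k * G k j) * (\<Sum>l\<in>I. G j l * G l j))"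
    by (subst sum_rotate_right) (simp only: sum_product)
  also have "\<dots> = (\<Sum>j\<in>I. of_nat d * of_nat d)"
    by (intro sum.cong refl) (simp add: gram_mult gram_diag)
  also have "\<dots> = (of_nat d)^4"
    by (simp add: card_index power4_eq_xxxx power2_eq_square)
  finally show ?thesis .
qed

text \<open>The second frame potential. The equal overlaps enter here; the value is the Welch bound
  for d^2 unit vectors, whose attainment characterizes 2-designs.\<close>

lemma gram_quartic_sum:
  "(\<Sum>j\<in>I. \<Sum>i\<in>I. (G j i * G i j)\<^sup>2) = 2 * (of_nat d)^3 / (of_nat d + 1)"
proof -
  define e :: complex where "e = 1 / (of_nat d + 1)"
  have nz: "of_nat d + 1 \<noteq> (0::complex)"
    by (metis of_nat_Suc of_nat_neq_0 add.commute)
  have off: "G j i * G i j = e" if "j \<in> I" "i \<in> I" "j \<noteq> i" for j i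
  proof -
    have "G j i * G i j = of_real ((cmod (G j i))\<^sup>2)"
      by (simp only: gram_cnj[symmetric, of j i] complex_norm_square complex_cnj_cnj)
    then show ?thesis using gram_off_diag[OF that] by (simp add: e_def)
  qed
  have row: "(\<Sum>i\<in>I. (G j i * G i j)\<^sup>2) = 1 + (of_nat (d\<^sup>2) - 1) * e\<^sup>2" if j: "j \<in> I" for j
  proof -
    have "(\<Sum>i\<in>I. (G j i * G i j)\<^sup>2) = (G j j * G j j)\<^sup>2 + (\<Sum>i\<in>I - {j}. (G j i * G i j)\<^sup>2)"
      by (rule sum.remove[OF finite_index j])
    also have "(\<Sum>i\<in>I - {j}. (G j i * G i j)\<^sup>2) = (\<Sum>i\<in>I - {j}. e\<^sup>2)"
      using off j by (intro sum.cong) auto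
    also have "\<dots> = (of_nat (d\<^sup>2) - 1) * e\<^sup>2"
      using j dim_pos by (simp add: card_Diff_singleton card_index)
    finally show ?thesis by (simp add: gram_diag j)
  qed
  have "(\<Sum>j\<in>I. \<Sum>i\<in>I. (G j i * G i j)\<^sup>2) = of_nat (d\<^sup>2) * (1 + (of_nat (d\<^sup>2) - 1) * e\<^sup>2)"
    by (simp add: row card_index)
  \<comment> \<open>Since d^2 - 1 = (d - 1)(d + 1), each row sums to 1 + (d - 1)/(d + 1).\<close>
  also have "1 + (of_nat (d\<^sup>2) - 1) * e\<^sup>2 = 2 * of_nat d / (of_nat d + 1)"
    using nz by (simp add: e_def divide_simps) (simp add: power2_eq_square algebra_simps)
  finally show ?thesis
    by (simp add: power2_eq_square power3_eq_cube)
qed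

text \<open>Each of the four sums over \<open>k\<close>, \<open>l\<close>, \<open>p\<close>,
  \<open>q\<close> collapses by \<open>gram_mult\<close> with a factor \<open>d\<close>, leaving d^4
  times the frame potential.\<close>

lemma fourth_moment_mult_trace:
  "(\<Sum>k\<in>I. \<Sum>l\<in>I. \<Sum>p\<in>I. \<Sum>q\<in>I. fourth_moment k l p q * fourth_moment p q k l)
   = 2 * (of_nat d)^7 / (of_nat d + 1)"
proof -
  have "(\<Sum>p\<in>I. \<Sum>q\<in>I. fourth_moment k l p q * fourth_moment p q k l)
      = (of_nat d)\<^sup>2 * (\<Sum>i\<in>I. \<Sum>j\<in>I. (G j i)\<^sup>2 * ((G i k * G k j) * (G i l * G l j)))" for k l
  proof -
    have "(\<Sum>p\<in>I. \<Sum>q\<in>I. fourth_moment k l p q * fourth_moment p q k l)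
        = (\<Sum>p\<in>I. \<Sum>q\<in>I. \<Sum>i\<in>I. (G i k * G i l) * (fourth_moment k l p q * (G p i * G q i)))"
      by (simp add: fourth_moment_def[of _ _ k l] sum_distrib_left mult_ac)
    also have "\<dots> = (\<Sum>i\<in>I. (G i k * G i l) *
        (\<Sum>p\<in>I. \<Sum>q\<in>I. fourth_moment k l p q * (G p i * G q i)))"
      by (subst sum_rotate_right) (simp only: sum_distrib_left)
    also have "\<dots> = (\<Sum>i\<in>I. (G i k * G i l) *
        (\<Sum>j\<in>I. (G k j * G l j) * ((of_nat d * G j i) * (of_nat d * G j i))))"
      unfolding fourth_moment_contract by (simp add: gram_mult)
    also have "\<dots> = (of_nat d)\<^sup>2 * (\<Sum>i\<in>I. \<Sum>j\<in>I. (G j i)\<^sup>2 * ((G i k * G k j) * (G i l * G l j)))"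
      by (simp add: sum_distrib_left power2_eq_square mult_ac)
    finally show ?thesis .
  qed
  then have "(\<Sum>k\<in>I. \<Sum>l\<in>I. \<Sum>p\<in>I. \<Sum>q\<in>I. fourth_moment k l p q * fourth_moment p q k l)
      = (of_nat d)\<^sup>2 * (\<Sum>k\<in>I. \<Sum>l\<in>I. \<Sum>i\<in>I. \<Sum>j\<in>I.
          (G j i)\<^sup>2 * ((G i k * G k j) * (G i l * G l j)))"
    by (simp add: sum_distrib_left)
  also have "(\<Sum>k\<in>I. \<Sum>l\<in>I. \<Sum>i\<in>I. \<Sum>j\<in>I. (G j i)\<^sup>2 * ((G i k * G k j) * (G i l * G l j)))
      = (\<Sum>i\<in>I. \<Sum>j\<in>I. (G j i)\<^sup>2 * ((\<Sum>k\<in>I. G i k * G k j) * (\<Sum>l\<in>I. G i l * G l j)))"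
    by (subst sum_swap_pairs) (simp only: sum_product, simp only: sum_distrib_left)
  also have "\<dots> = (\<Sum>i\<in>I. \<Sum>j\<in>I. (of_nat d)\<^sup>2 * (G i j * G j i)\<^sup>2)"
    by (intro sum.cong refl) (simp add: gram_mult power2_eq_square)
  also have "\<dots> = (of_nat d)\<^sup>2 * (2 * (of_nat d)^3 / (of_nat d + 1))"
    by (simp only: sum_distrib_left[symmetric] gram_quartic_sum)
  finally show ?thesis
    by (simp add: power_numeral_reduce)
qed

text \<open>
  A SIC is a projective 2-design: the Hilbert--Schmidt norm of the difference of the two sides
  expands into the traces computed above, which cancel.
\<close>
lemma fourth_moment_eq_sym_kernel:
  assumes "k \<in> I" "l \<in> I" "m \<in> I" "n \<in> I"
  shows "fourth_moment k l m n = of_nat d / (of_nat d + 1) * sym_kernel k l m n"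
proof -
  \<comment> \<open>The only multiple compatible with the traces: d^4 = c (d^4 + d^3).\<close>
  define c :: complex where "c = of_nat d / (of_nat d + 1)"
  define F where "F k l m n = fourth_moment k l m n - c * sym_kernel k l m n" for k l m n
  have nz: "of_nat d + 1 \<noteq> (0::complex)"
    by (metis of_nat_Suc of_nat_neq_0 add.commute)
  have F_cnj: "cnj (F k l m n) = F m n k l" for k l m n
    by (simp add: F_def fourth_moment_cnj sym_kernel_cnj c_def)
  \<comment> \<open>Both matrices are Hermitian, so conjugation reverses the order of the
    product.\<close>
  have mult_cnj: "(\<Sum>p\<in>I. \<Sum>q\<in>I. sym_kernel k l p q * fourth_moment p q k l)
      = 2 * (of_nat d)\<^sup>2 * fourth_moment k l k l" if "k \<in> I" "l \<in> I" for k l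
    using arg_cong[OF fourth_moment_mult_sym_kernel[OF that, of k l], of cnj]
    by (simp add: fourth_moment_cnj sym_kernel_cnj mult.commute)
  have "(\<Sum>p\<in>I. \<Sum>q\<in>I. F k l p q * F p q k l)
      = (\<Sum>p\<in>I. \<Sum>q\<in>I. fourth_moment k l p q * fourth_moment p q k l)
        - 4 * c * (of_nat d)\<^sup>2 * fourth_moment k l k l
        + 2 * c\<^sup>2 * (of_nat d)\<^sup>2 * sym_kernel k l k l" if kl: "k \<in> I" "l \<in> I" for k l
  proof -
    have "(\<Sum>p\<in>I. \<Sum>q\<in>I. F k l p q * F p q k l)
        = (\<Sum>p\<in>I. \<Sum>q\<in>I. fourth_moment k l p q * fourth_moment p q k l)
        - c * (\<Sum>p\<in>I. \<Sum>q\<in>I. fourth_moment k l p q * sym_kernel p q k l)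
        - c * (\<Sum>p\<in>I. \<Sum>q\<in>I. sym_kernel k l p q * fourth_moment p q k l)
        + c\<^sup>2 * (\<Sum>p\<in>I. \<Sum>q\<in>I. sym_kernel k l p q * sym_kernel p q k l)"
      unfolding sum_distrib_left sum_subtractf[symmetric] sum.distrib[symmetric]
      by (intro sum.cong refl) (simp add: F_def power2_eq_square algebra_simps)
    then show ?thesis
      unfolding fourth_moment_mult_sym_kernel[OF kl] mult_cnj[OF kl]
        sym_kernel_mult_sym_kernel[OF kl kl] by simp
  qed
  then have "(\<Sum>k\<in>I. \<Sum>l\<in>I. \<Sum>p\<in>I. \<Sum>q\<in>I. F k l p q * F p q k l)
      = (\<Sum>k\<in>I. \<Sum>l\<in>I. \<Sum>p\<in>I. \<Sum>q\<in>I. fourth_moment k l p q * fourth_moment p q k l)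
        - 4 * c * (of_nat d)\<^sup>2 * (\<Sum>k\<in>I. \<Sum>l\<in>I. fourth_moment k l k l)
        + 2 * c\<^sup>2 * (of_nat d)\<^sup>2 * (\<Sum>k\<in>I. \<Sum>l\<in>I. sym_kernel k l k l)"
    by (simp add: sum.distrib sum_subtractf sum_distrib_left)
  also have "\<dots> = 2 * (of_nat d)^7 / (of_nat d + 1) - 4 * c * (of_nat d)\<^sup>2 * (of_nat d)^4
        + 2 * c\<^sup>2 * (of_nat d)\<^sup>2 * ((of_nat d)^4 + (of_nat d)^3)"
    by (simp only: fourth_moment_mult_trace fourth_moment_trace sym_kernel_trace)
  \<comment> \<open>The three terms are 2, -4 and 2 times d^7 / (d + 1).\<close>
  also have "\<dots> = 0"
    unfolding c_def using nz
    by (simp add: divide_simps) (simp add: power_numeral_reduce algebra_simps)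
  finally have "(\<Sum>k\<in>I. \<Sum>l\<in>I. \<Sum>p\<in>I. \<Sum>q\<in>I. F k l p q * F p q k l) = 0" .
  \<comment> \<open>\<open>F\<close> is Hermitian, so the vanishing trace of its square is a sum of
    squared moduli.\<close>
  moreover have "F k l p q * F p q k l = of_real ((cmod (F k l p q))\<^sup>2)" for k l p q
    by (simp add: F_cnj[symmetric, of p q k l] complex_norm_square del: of_real_power)
  ultimately have "complex_of_real (\<Sum>k\<in>I. \<Sum>l\<in>I. \<Sum>p\<in>I. \<Sum>q\<in>I. (cmod (F k l p q))\<^sup>2) = 0"
    by simp
  then have "(\<Sum>k\<in>I. \<Sum>l\<in>I. \<Sum>p\<in>I. \<Sum>q\<in>I. (cmod (F k l p q))\<^sup>2) = 0"
    by (simp only: of_real_eq_0_iff)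
  then have "F k l m n = 0"
    using assms finite_index by (simp add: sum_nonneg_eq_0_iff sum_nonneg)
  then show ?thesis by (simp add: F_def c_def)
qed

text \<open>The hypotheses say that \<open>G\<close> reproduces the rows and columns of
  \<open>M\<close> up to the factor \<open>d\<close>, as it does for the matrix of an operator in
  the frame. Expanding \<open>d * M j j\<close> by \<open>right\<close> turns the squares into
  contractions with \<open>fourth_moment\<close>.\<close>

lemma sum_diag_squares:
  assumes left: "\<And>j k. j \<in> I \<Longrightarrow> k \<in> I \<Longrightarrow> (\<Sum>p\<in>I. G j p * M p k) = of_nat d * M j k"
    and right: "\<And>j k. j \<in> I \<Longrightarrow> k \<in> I \<Longrightarrow> (\<Sum>p\<in>I. M j p * G p k) = of_nat d * M j k"
  shows "(of_nat d)\<^sup>2 * (\<Sum>j\<in>I. (M j j)\<^sup>2)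
       = of_nat d / (of_nat d + 1) * ((\<Sum>j\<in>I. M j j)\<^sup>2 + (\<Sum>j\<in>I. \<Sum>k\<in>I. M j k * M k j))"
proof -
  define D :: complex where "D = of_nat d"
  have D2: "D\<^sup>2 \<noteq> 0" using dim_pos by (simp add: D_def)
  \<comment> \<open>The factor \<open>D\<^sup>2\<close> lets \<open>left\<close> write both entries
    of \<open>M\<close> as sums against \<open>G\<close>, exposing \<open>fourth_moment\<close>;
    after the 2-design identity, \<open>left\<close> yields the same factor again and it
    cancels.\<close>
  have moment: "(\<Sum>j\<in>I. (G k j * G l j) * (M j k * M j l)) =
      D / (D + 1) * (M k k * M l l + M l k * M k l)"
    if kl: "k \<in> I" "l \<in> I" for k l
  proof -
    have "D\<^sup>2 * (\<Sum>j\<in>I. (G k j * G l j) * (M j k * M j l))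
        = (\<Sum>j\<in>I. (G k j * G l j) * ((\<Sum>p\<in>I. G j p * M p k) * (\<Sum>q\<in>I. G j q * M q l)))"
      by (simp add: left kl sum_distrib_left power2_eq_square D_def mult_ac)
    also have "\<dots> = (\<Sum>p\<in>I. \<Sum>q\<in>I. fourth_moment k l p q * (M p k * M q l))"
      by (rule fourth_moment_contract[symmetric])
    also have "\<dots> = D / (D + 1) * (\<Sum>p\<in>I. \<Sum>q\<in>I. sym_kernel k l p q * (M p k * M q l))"
      by (simp add: fourth_moment_eq_sym_kernel kl sum_distrib_left D_def mult_ac)
    also have "\<dots> = D\<^sup>2 * (D / (D + 1) * (M k k * M l l + M l k * M k l))"
      unfolding sym_kernel_contract
      by (simp add: left kl D_def power2_eq_square algebra_simps)
    finally have "D\<^sup>2 * (\<Sum>j\<in>I. (G k j * G l j) * (M j k * M j l))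
        = D\<^sup>2 * (D / (D + 1) * (M k k * M l l + M l k * M k l))" .
    then show ?thesis by (rule mult_left_cancel[OF D2, THEN iffD1])
  qed
  have "D\<^sup>2 * (\<Sum>j\<in>I. (M j j)\<^sup>2)
      = (\<Sum>j\<in>I. (\<Sum>k\<in>I. M j k * G k j) * (\<Sum>l\<in>I. M j l * G l j))"
    by (subst sum_distrib_left, intro sum.cong refl) (simp add: right power2_eq_square D_def)
  also have "\<dots> = (\<Sum>j\<in>I. \<Sum>k\<in>I. \<Sum>l\<in>I. (G k j * G l j) * (M j k * M j l))"
    by (simp add: sum_product mult_ac)
  also have "\<dots> = (\<Sum>k\<in>I. \<Sum>l\<in>I. \<Sum>j\<in>I. (G k j * G l j) * (M j k * M j l))"
    by (rule sum_rotate_right[symmetric])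
  also have "\<dots> = (\<Sum>k\<in>I. \<Sum>l\<in>I. D / (D + 1) * (M k k * M l l + M l k * M k l))"
    by (intro sum.cong refl moment)
  also have "\<dots> = D / (D + 1) * ((\<Sum>j\<in>I. M j j)\<^sup>2 + (\<Sum>j\<in>I. \<Sum>k\<in>I. M j k * M k j))"
    by (simp add: power2_eq_square sum_product sum.distrib sum_distrib_left distrib_left mult_ac)
  finally show ?thesis by (simp only: D_def)
qed

end

section \<open>From the Hilbert space to frame matrices and back\<close>

context complex_hilbert_space
begin

lemma inner_zero_right: "inner x 0 = 0"
  using inner_add_right[of x 0 0] by simp

lemma inner_sum_right: "inner x (\<Sum>i\<in>A. f i) = (\<Sum>i\<in>A. inner x (f i))"
  by (induction A rule: infinite_finite_induct) (simp_all add: inner_zero_right inner_add_right)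

lemma frame_expansion:
  assumes "sic_povm \<phi>"
  shows "(\<Sum>j\<in>{1..(dim UNIV)\<^sup>2}. inner (\<phi> j) x *s \<phi> j) = of_nat (dim UNIV) *s x"
proof (cases "dim UNIV = 0")
  \<comment> \<open>In dimension zero the index range is empty and the scalar on the right is
    0.\<close>
  case True
  then show ?thesis by simp
next
  case False
  have "of_nat (dim UNIV) *s x =
      of_nat (dim UNIV) *s (\<Sum>j\<in>{1..(dim UNIV)\<^sup>2}. povm_element \<phi> j x)"
    using assms by (simp add: sic_povm_def)
  also have "\<dots> = (\<Sum>j\<in>{1..(dim UNIV)\<^sup>2}. inner (\<phi> j) x *s \<phi> j)"
    using False by (simp add: povm_element_def ketbra_def scale_sum_right)
  finally show ?thesis by simp
qed

lemma frame_inner: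
  assumes "sic_povm \<phi>"
  shows "(\<Sum>j\<in>{1..(dim UNIV)\<^sup>2}. inner x (\<phi> j) * inner (\<phi> j) y)
       = of_nat (dim UNIV) * inner x y"
  using arg_cong[OF frame_expansion[OF assms, of y], of "inner x"]
  by (simp add: inner_sum_right inner_scale_right mult.commute)

text \<open>\<open>Basis\<close> need not be orthonormal, so coordinates are taken as linear
  functionals: the frame expansion of \<open>A b\<close> is read off at \<open>b\<close>, the sums
  are exchanged, and each \<open>\<phi> j\<close> is reassembled from its coordinates.\<close>

lemma op_trace_frame:
  assumes sic: "sic_povm \<phi>" and lin: "Vector_Spaces.linear scale scale A"
  shows "of_nat (dim UNIV) * op_trace A
       = (\<Sum>j\<in>{1..(dim UNIV)\<^sup>2}. inner (\<phi> j) (A (\<phi> j)))"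
proof -
  interpret A: Vector_Spaces.linear scale scale A by (rule lin)
  let ?R = "representation Basis"
  have expand: "(\<Sum>b\<in>Basis. ?R x b *s b) = x" for x
    by (rule sum_representation_eq)
      (simp_all add: independent_Basis span_Basis finite_Basis)
  have coord: "of_nat (dim UNIV) * ?R x b
      = (\<Sum>j\<in>{1..(dim UNIV)\<^sup>2}. inner (\<phi> j) x * ?R (\<phi> j) b)" for x b
    using arg_cong[OF frame_expansion[OF sic, of x], of "\<lambda>y. ?R y b"]
    by (simp add: representation_sum representation_scale independent_Basis span_Basis)
  have "of_nat (dim UNIV) * op_trace A
      = (\<Sum>b\<in>Basis. \<Sum>j\<in>{1..(dim UNIV)\<^sup>2}. inner (\<phi> j) (A b) * ?R (\<phi> j) b)"
    by (simp only: op_trace_def sum_distrib_left coord)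
  also have "\<dots> = (\<Sum>j\<in>{1..(dim UNIV)\<^sup>2}. \<Sum>b\<in>Basis. inner (\<phi> j) (A b) * ?R (\<phi> j) b)"
    by (rule sum.swap)
  also have "\<dots> = (\<Sum>j\<in>{1..(dim UNIV)\<^sup>2}. inner (\<phi> j) (A (\<Sum>b\<in>Basis. ?R (\<phi> j) b *s b)))"
    by (simp add: A.sum A.scale inner_sum_right inner_scale_right mult.commute)
  finally show ?thesis by (simp only: expand)
qed

lemma sic_gram_inner:
  assumes sic: "sic_povm \<phi>" and "0 < dim UNIV"
  shows "sic_gram {1..(dim UNIV)\<^sup>2} (\<lambda>j k. inner (\<phi> j) (\<phi> k)) (dim UNIV)"
  using assms frame_inner[OF sic]
  by unfold_locales (auto simp: sic_povm_def inner_commute[symmetric])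

text \<open>Completeness inserted to the right of \<open>A\<close>; together with
  \<open>frame_inner\<close>, which inserts it on the left, this gives the reproducing hypotheses of
  \<open>sum_diag_squares\<close>.\<close>

lemma linear_frame_inner:
  assumes sic: "sic_povm \<phi>" and lin: "Vector_Spaces.linear scale scale A"
  shows "(\<Sum>j\<in>{1..(dim UNIV)\<^sup>2}. inner x (A (\<phi> j)) * inner (\<phi> j) y)
       = of_nat (dim UNIV) * inner x (A y)"
proof -
  interpret A: Vector_Spaces.linear scale scale A by (rule lin)
  show ?thesis
    using arg_cong[OF frame_expansion[OF sic, of y], of "\<lambda>z. inner x (A z)"]
    by (simp add: A.sum A.scale inner_sum_right inner_scale_right mult.commute)
qed

lemma sum_sic_prob_squares:
  assumes sic: "sic_povm \<phi>" and lin: "Vector_Spaces.linear scale scale A"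
    and pos: "0 < dim UNIV"
  shows "(\<Sum>j\<in>{1..(dim UNIV)\<^sup>2}. (sic_prob \<phi> A j)\<^sup>2)
       = (op_trace (A \<circ> A) + (op_trace A)\<^sup>2) / (of_nat (dim UNIV) * (of_nat (dim UNIV) + 1))"
proof -
  define I where "I = {1..(dim UNIV)\<^sup>2}"
  define D :: complex where "D = of_nat (dim UNIV)"
  define M where "M j k = inner (\<phi> j) (A (\<phi> k))" for j k
  have D: "D \<noteq> 0" "D + 1 \<noteq> 0"
    using pos by (simp_all add: D_def) (metis of_nat_Suc of_nat_neq_0 add.commute)
  then have D2: "D\<^sup>2 \<noteq> 0" by simp
  interpret sic_gram I "\<lambda>j k. inner (\<phi> j) (\<phi> k)" "dim UNIV"
    unfolding I_def by (rule sic_gram_inner[OF sic pos])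
  have squares: "D\<^sup>2 * (\<Sum>j\<in>I. (M j j)\<^sup>2)
      = D / (D + 1) * ((\<Sum>j\<in>I. M j j)\<^sup>2 + (\<Sum>j\<in>I. \<Sum>k\<in>I. M j k * M k j))"
    unfolding D_def
    by (rule sum_diag_squares)
      (simp_all only: M_def I_def frame_inner[OF sic] linear_frame_inner[OF sic lin])
  have lin2: "Vector_Spaces.linear scale scale (A \<circ> A)"
    using lin lin by (rule Vector_Spaces.linear_compose)
  have trace: "(\<Sum>j\<in>I. M j j) = D * op_trace A"
    using op_trace_frame[OF sic lin] by (simp only: M_def I_def D_def)
  \<comment> \<open>The sum over \<open>k\<close> is completeness between the two copies of
    \<open>A\<close>.\<close>
  have "(\<Sum>j\<in>I. \<Sum>k\<in>I. M j k * M k j) = (\<Sum>j\<in>I. D * inner (\<phi> j) ((A \<circ> A) (\<phi> j)))"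
    by (simp only: M_def I_def D_def linear_frame_inner[OF sic lin] o_apply)
  also have "\<dots> = D * (D * op_trace (A \<circ> A))"
    using op_trace_frame[OF sic lin2] by (simp only: sum_distrib_left[symmetric] I_def D_def)
  finally have "D\<^sup>2 * (\<Sum>j\<in>I. (M j j)\<^sup>2)
      = D\<^sup>2 * (D / (D + 1) * (op_trace (A \<circ> A) + (op_trace A)\<^sup>2))"
    using squares trace by (simp add: power2_eq_square algebra_simps)
  then have "(\<Sum>j\<in>I. (M j j)\<^sup>2) = D / (D + 1) * (op_trace (A \<circ> A) + (op_trace A)\<^sup>2)"
    by (rule mult_left_cancel[OF D2, THEN iffD1])
  moreover have "(\<Sum>j\<in>I. (sic_prob \<phi> A j)\<^sup>2) = (\<Sum>j\<in>I. (M j j)\<^sup>2) / D\<^sup>2"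
    by (simp add: sic_prob_def M_def D_def power_mult_distrib power_divide sum_divide_distrib)
  ultimately have "(\<Sum>j\<in>I. (sic_prob \<phi> A j)\<^sup>2)
      = D / (D + 1) * (op_trace (A \<circ> A) + (op_trace A)\<^sup>2) / D\<^sup>2"
    by simp
  also have "\<dots> = (op_trace (A \<circ> A) + (op_trace A)\<^sup>2) / (D * (D + 1))"
    using D by (simp add: power2_eq_square)
  finally show ?thesis by (simp only: I_def D_def)
qed

text \<open>In dimension zero the trace is an empty sum, which cannot equal 1.\<close>

lemma density_operator_dim_pos:
  assumes "density_operator \<rho>"
  shows "0 < dim UNIV"
proof (rule ccontr)
  assume "\<not> 0 < dim UNIV"
  then have "Basis = {}" using finite_Basis by simp
  moreover have "op_trace \<rho> = 1" using assms by (simp add: density_operator_def)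
  ultimately show False unfolding op_trace_def by simp
qed

end

theorem proposition5:
  fixes scale :: "complex \<Rightarrow> 'a::ab_group_add \<Rightarrow> 'a"
    and Basis :: "'a set"
    and inner :: "'a \<Rightarrow> 'a \<Rightarrow> complex"
    and \<phi> :: "nat \<Rightarrow> 'a"
    and \<rho> :: "'a \<Rightarrow> 'a"
    and d :: nat
  assumes "complex_hilbert_space scale Basis inner"
    and "vector_space.dim scale UNIV = d"
    and "complex_hilbert_space.sic_povm scale inner \<phi>"
    and "complex_hilbert_space.density_operator scale Basis inner \<rho>"
  shows "(\<Sum>j\<in>{1..d\<^sup>2}. (complex_hilbert_space.sic_prob scale inner \<phi> \<rho> j)\<^sup>2)
       = (complex_hilbert_space.op_trace scale Basis (\<rho> \<circ> \<rho>) + 1) / (of_nat d * (of_nat d + 1))"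
proof -
  interpret complex_hilbert_space scale Basis inner by (rule assms(1))
  have lin: "Vector_Spaces.linear scale scale \<rho>" and tr: "op_trace \<rho> = 1"
    using assms(4) by (auto simp: density_operator_def positive_semidefinite_def)
  show ?thesis
    using sum_sic_prob_squares[OF assms(3) lin density_operator_dim_pos[OF assms(4)]]
    unfolding assms(2) tr by simp
qed

end
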